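(* Let $N\ge2$ and $\phi\in\mathbb{R}$, and let $|\Psi_\phi\rangle=\frac{1}{\sqrt2}\left(|0\rangle^{\otimes N}+e^{i\phi}|1\rangle^{\otimes N}\right)\in(\mathbb{C}^2)^{\otimes N}$. Define $$\mathcal{W}^2_{\Psi_\phi}=\tfrac12\,\mathbb{I}-\mathcal{Z}-\tfrac14\left(\cos\phi\,\mathcal{M}_x+\sin\phi\,\mathcal{M}_x'\right),$$ where $\mathcal{Z}=\frac12\left((|0\rangle\langle0|)^{\otimes N}+(|1\rangle\langle1|)^{\otimes N}\right)$, $\mathcal{M}_x=\sigma_x^{\otimes N}$ and $\mathcal{M}_x'=\sigma_y\otimes\sigma_x^{\otimes (N-1)}$. Then $\mathcal{W}^2_{\Psi_\phi}$ is an entanglement witness that detects entanglement near $|\Psi_\phi\rangle$, that is, $\mathrm{Tr}(\mathcal{W}^2_{\Psi_\phi}\sigma_s)\ge0$ for every $\sigma_s\in\mathcal{S}_{sep}$, and $\langle\Psi_\phi|\mathcal{W}^2_{\Psi_\phi}|\Psi_\phi\rangle<0$.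
   Context: The Hilbert space is that of $N$ qubits, $(\mathbb{C}^2)^{\otimes N}$; $\sigma_x,\sigma_y$ are the Pauli matrices and $\mathbb{I}$ is the identity. The superscript $2$ in $\mathcal{W}^2_{\Psi_\phi}$ is a label, not a power. $\mathcal{S}_{sep}$ denotes the convex set of separable $N$-qubit states relevant to genuine multipartite entanglement: the convex hull of all pure states $|\chi\rangle\langle\chi|$ such that $|\chi\rangle=|\alpha\rangle_A\otimes|\beta\rangle_{\bar A}$ for some bipartition $A\sqcup\bar A$ of the $N$ qubits into two nonempty sets (the bipartition may differ from one term of the mixture to another). An entanglement witness detecting a state $\rho$ is a Hermitian operator $\mathcal{W}$ with $\mathrm{Tr}(\mathcal{W}\sigma_s)\ge0$ for all $\sigma_s\in\mathcal{S}_{sep}$ and $\mathrm{Tr}(\mathcal{W}\rho)<0$. *)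

theory Defs
  imports "HOL-Analysis.Analysis" "HOL-Library.Complex_Order"
begin

text \<open>
  The qubits are labelled by the elements of a finite type \<open>'n\<close>, so the number of qubits is
  \<open>CARD('n)\<close>. The \<open>N\<close>-qubit space is given in coordinates with respect to the computational
  product basis, which is indexed by the bit strings \<open>'n \<Rightarrow> 2\<close>; the elements of the
  type \<open>2\<close> are \<open>0\<close> and \<open>1\<close>. Inequalities between complex numbers are those of
  \<open>Complex_Order\<close>: \<open>0 \<le> z\<close> says that \<open>z\<close> is real and nonnegative, and
  \<open>z < 0\<close> that \<open>z\<close> is real and negative.
\<close>

type_synonym 'n qvec = "complex ^ ('n \<Rightarrow> 2)"
type_synonym 'n qop = "complex ^ ('n \<Rightarrow> 2) ^ ('n \<Rightarrow> 2)"

definition braket :: "complex ^ 'a \<Rightarrow> complex ^ 'a \<Rightarrow> complex" where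
  "braket u v = (\<Sum>i\<in>UNIV. cnj (u $ i) * v $ i)"

definition ketbra :: "complex ^ 'a \<Rightarrow> complex ^ 'a \<Rightarrow> complex ^ 'a ^ 'a" where
  "ketbra u v = (\<chi> i j. u $ i * cnj (v $ j))"

definition conj_transpose :: "complex ^ 'a ^ 'a \<Rightarrow> complex ^ 'a ^ 'a" where
  "conj_transpose A = (\<chi> i j. cnj (A $ j $ i))"

definition hermitian :: "complex ^ 'a ^ 'a \<Rightarrow> bool" where
  "hermitian A \<longleftrightarrow> conj_transpose A = A"

definition ket0 :: "complex ^ 2" where
  "ket0 = axis 0 1"

definition ket1 :: "complex ^ 2" where
  "ket1 = axis 1 1"

text \<open>
  The Pauli matrices are not written with \<open>vector [\<dots>]\<close>, because that function uses the index
  order \<open>1, 2\<close> and \<open>2 = 0\<close> in the type \<open>2\<close>.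
\<close>

definition sigma_x :: "complex ^ 2 ^ 2" where
  "sigma_x = (\<chi> i j. if i = j then 0 else 1)"

definition sigma_y :: "complex ^ 2 ^ 2" where
  "sigma_y = (\<chi> i j. if i = 0 \<and> j = 1 then - \<i> else if i = 1 \<and> j = 0 then \<i> else 0)"

definition tensor_vec :: "('n::finite \<Rightarrow> complex ^ 2) \<Rightarrow> 'n qvec" where
  "tensor_vec v = (\<chi> s. \<Prod>k\<in>UNIV. v k $ s k)"

definition tensor_op :: "('n::finite \<Rightarrow> complex ^ 2 ^ 2) \<Rightarrow> 'n qop" where
  "tensor_op F = (\<chi> s t. \<Prod>k\<in>UNIV. F k $ s k $ t k)"

text \<open>
  A vector of the subsystem \<open>A\<close> is given by its coefficients \<open>\<alpha>\<close> at the bit strings on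
  \<open>A\<close>, represented as functions that are \<open>undefined\<close> outside \<open>A\<close>; values of \<open>\<alpha>\<close>
  at other arguments play no role.
\<close>

definition tensor_bipart ::
  "'n set \<Rightarrow> (('n \<Rightarrow> 2) \<Rightarrow> complex) \<Rightarrow> (('n \<Rightarrow> 2) \<Rightarrow> complex) \<Rightarrow> ('n::finite) qvec" where
  "tensor_bipart A \<alpha> \<beta> = (\<chi> s. \<alpha> (restrict s A) * \<beta> (restrict s (- A)))"

definition biproduct :: "('n::finite) qvec \<Rightarrow> bool" where
  "biproduct \<psi> \<longleftrightarrow> (\<exists>A \<alpha> \<beta>. A \<noteq> {} \<and> - A \<noteq> {} \<and> \<psi> = tensor_bipart A \<alpha> \<beta>)"

definition sep_states :: "('n::finite) qop set" where
  "sep_states = convex hull {ketbra \<psi> \<psi> | \<psi>. norm \<psi> = 1 \<and> biproduct \<psi>}"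

definition entanglement_witness :: "('n::finite) qop \<Rightarrow> 'n qop \<Rightarrow> bool" where
  "entanglement_witness W \<rho> \<longleftrightarrow>
     hermitian W \<and> (\<forall>\<sigma>\<in>sep_states. 0 \<le> trace (W ** \<sigma>)) \<and> trace (W ** \<rho>) < 0"

definition ghz :: "real \<Rightarrow> ('n::finite) qvec" where
  "ghz \<phi> = (1 / sqrt 2) *\<^sub>R
     (tensor_vec (\<lambda>_. ket0) + exp (\<i> * complex_of_real \<phi>) *s tensor_vec (\<lambda>_. ket1))"

definition Z_op :: "('n::finite) qop" where
  "Z_op = (1 / 2) *\<^sub>R
     (tensor_op (\<lambda>_. ketbra ket0 ket0) + tensor_op (\<lambda>_. ketbra ket1 ket1))"

definition Mx_op :: "('n::finite) qop" where
  "Mx_op = tensor_op (\<lambda>_. sigma_x)"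

text \<open>Here \<open>q\<close> is the label of the qubit that is counted as the first one.\<close>

definition Mx'_op :: "'n \<Rightarrow> ('n::finite) qop" where
  "Mx'_op q = tensor_op (\<lambda>k. if k = q then sigma_y else sigma_x)"

definition W2 :: "'n \<Rightarrow> real \<Rightarrow> ('n::finite) qop" where
  "W2 q \<phi> = (1 / 2) *\<^sub>R mat 1 - Z_op - (1 / 4) *\<^sub>R (cos \<phi> *\<^sub>R Mx_op + sin \<phi> *\<^sub>R Mx'_op q)"

end

theory Submission
  imports Defs
begin

text \<open>
  For \<open>\<psi>\<close> with coordinates \<open>\<psi>\<^sub>s\<close>, write \<open>r\<^sub>s = \<bar>\<psi>\<^sub>s\<bar>\<close> and let \<open>s'\<close> be the bitwise complement of \<open>s\<close>.
  The operator \<open>cos \<phi> M\<^sub>x + sin \<phi> M\<^sub>x'\<close> maps \<open>s'\<close> to \<open>s\<close> up to a phase, so the expectation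
  value of the witness is at least the sum of \<open>r\<^sub>s\<^sup>2 / 2 - r\<^sub>s r\<^sub>s' / 4\<close> over the nonconstant strings,
  minus \<open>r\<^sub>0 r\<^sub>1 / 2\<close>. By AM-GM the sum is at least a quarter of \<open>\<Sum> r\<^sub>s\<^sup>2\<close> over
  these strings. If \<open>\<psi>\<close> factorises along
  \<open>A\<close>, and \<open>u\<close> is the string that is \<open>0\<close> exactly on \<open>A\<close>, then \<open>r\<^sub>0 r\<^sub>1 = r\<^sub>u r\<^sub>u'\<close>, which is at most
  \<open>(r\<^sub>u\<^sup>2 + r\<^sub>u'\<^sup>2) / 2\<close>. The GHZ state is an eigenvector with eigenvalue \<open>-1/4\<close>.
\<close>

lemma bit_cases: "(b :: 2) = 0 \<or> b = 1"
  using exhaust_2[of b] by auto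

lemma prod_of_bool:
  assumes "finite A"
  shows "(\<Prod>k\<in>A. of_bool (P k)) = (of_bool (\<forall>k\<in>A. P k) :: 'a :: comm_semiring_1)"
  using assms by (induction A rule: finite_induct) auto

definition flip :: "('n \<Rightarrow> 2) \<Rightarrow> 'n \<Rightarrow> 2" where
  "flip s = (\<lambda>k. if s k = 0 then 1 else 0)"

lemma flip_flip [simp]: "flip (flip s) = s"
  using bit_cases by (fastforce simp: flip_def)

lemma flip_const [simp]: "flip (\<lambda>_. 0) = (\<lambda>_. 1)" "flip (\<lambda>_. 1) = (\<lambda>_. 0)"
  by (simp_all add: flip_def)

text \<open>The right-hand side is the condition under which every factor of an entry of
  \<open>Mx_op\<close> is nonzero.\<close>

lemma flip_eq_iff: "t = flip s \<longleftrightarrow> (\<forall>k. s k \<noteq> t k)"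
proof -
  have "t k = (if s k = 0 then 1 else 0) \<longleftrightarrow> s k \<noteq> t k" for k
    using bit_cases[of "s k"] bit_cases[of "t k"] by auto
  then show ?thesis
    by (simp add: flip_def fun_eq_iff)
qed

lemma flip_eq_const_iff [simp]:
  "flip s = (\<lambda>_. 0) \<longleftrightarrow> s = (\<lambda>_. 1)" "flip s = (\<lambda>_. 1) \<longleftrightarrow> s = (\<lambda>_. 0)"
  by (metis flip_flip flip_const)+

lemma const_bits_neq [simp]: "(\<lambda>_. 0 :: 2) \<noteq> (\<lambda>_. 1)" "(\<lambda>_. 1 :: 2) \<noteq> (\<lambda>_. 0)"
  by (simp_all add: fun_eq_iff)

text \<open>The only nonzero entry in row \<open>b\<close> of
  \<open>cos \<phi> * sigma_x + sin \<phi> * sigma_y\<close>.\<close>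

definition phase :: "real \<Rightarrow> 2 \<Rightarrow> complex" where
  "phase \<phi> b = (if b = 0 then cis (- \<phi>) else cis \<phi>)"

lemma norm_phase [simp]: "norm (phase \<phi> b) = 1"
  by (simp add: phase_def)

lemma phase_eq: "phase \<phi> b = of_real (cos \<phi>) + of_real (sin \<phi>) * (if b = 0 then - \<i> else \<i>)"
  by (simp add: phase_def complex_eq_iff)

lemma prod_sigma_x:
  "(\<Prod>k\<in>UNIV. sigma_x $ s k $ t k) = of_bool (t = flip (s :: 'n::finite \<Rightarrow> 2))"
proof -
  have "sigma_x $ a $ b = of_bool (a \<noteq> b)" for a b
    by (simp add: sigma_x_def)
  then show ?thesis
    by (simp add: prod_of_bool flip_eq_iff)
qed

text \<open>Factoring out the sign-dependent unit reduces the entries of \<open>Mx'_op\<close> to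
  those of \<open>Mx_op\<close>, times one factor from qubit \<open>q\<close>.\<close>

lemma sigma_y_eq: "sigma_y $ a $ b = (if a = 0 then - \<i> else \<i>) * sigma_x $ a $ b"
  using bit_cases[of a] bit_cases[of b] by (auto simp: sigma_x_def sigma_y_def)

lemma Mx_op_nth: "Mx_op $ s $ t = of_bool (t = flip s)"
  by (simp add: Mx_op_def tensor_op_def prod_sigma_x)

lemma Mx'_op_nth: "Mx'_op q $ s $ t = (if s q = 0 then - \<i> else \<i>) * of_bool (t = flip s)"
proof -
  have "Mx'_op q $ s $ t
      = (\<Prod>k\<in>UNIV. (if k = q then if s q = 0 then - \<i> else \<i> else 1) * sigma_x $ s k $ t k)"
    by (auto simp: Mx'_op_def tensor_op_def sigma_y_eq intro!: prod.cong)
  then show ?thesis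
    by (simp add: prod.distrib prod_sigma_x)
qed

lemma tensor_vec_ket_nth:
  "tensor_vec (\<lambda>_. ket0) $ s = of_bool (s = (\<lambda>_. 0))"
  "tensor_vec (\<lambda>_. ket1) $ s = of_bool (s = (\<lambda>_. 1))"
proof -
  have "ket0 $ b = of_bool (b = 0)" "ket1 $ b = of_bool (b = 1)" for b
    by (simp_all add: ket0_def ket1_def axis_def)
  then show "tensor_vec (\<lambda>_. ket0) $ s = of_bool (s = (\<lambda>_. 0))"
    "tensor_vec (\<lambda>_. ket1) $ s = of_bool (s = (\<lambda>_. 1))"
    by (simp_all add: tensor_vec_def prod_of_bool fun_eq_iff)
qed

lemma tensor_op_ketbra: "tensor_op (\<lambda>k. ketbra (u k) (v k)) = ketbra (tensor_vec u) (tensor_vec v)"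
  by (simp add: tensor_op_def ketbra_def tensor_vec_def prod.distrib)

lemma Z_op_nth: "Z_op $ s $ t = of_bool (s = t \<and> (s = (\<lambda>_. 0) \<or> s = (\<lambda>_. 1))) / 2"
  unfolding Z_op_def tensor_op_ketbra
  by (auto simp: ketbra_def tensor_vec_ket_nth scaleR_conv_of_real[where 'a = complex])

text \<open>\<open>Z_op\<close> cancels the diagonal entry 1/2 at the two constant strings and
  vanishes elsewhere; the Pauli products contribute only at complementary strings.\<close>

lemma W2_nth:
  "W2 q \<phi> $ s $ t
    = of_bool (s = t \<and> s \<noteq> (\<lambda>_. 0) \<and> s \<noteq> (\<lambda>_. 1)) / 2 - phase \<phi> (s q) * of_bool (t = flip s) / 4"
proof -
  have "W2 q \<phi> $ s $ t = of_bool (s = t) / 2 - Z_op $ s $ t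
      - (of_real (cos \<phi>) * Mx_op $ s $ t + of_real (sin \<phi>) * Mx'_op q $ s $ t) / 4"
    by (simp add: W2_def mat_def scaleR_conv_of_real[where 'a = complex])
  also have "of_real (cos \<phi>) * Mx_op $ s $ t + of_real (sin \<phi>) * Mx'_op q $ s $ t
      = phase \<phi> (s q) * of_bool (t = flip s)"
    by (simp add: Mx_op_nth Mx'_op_nth phase_eq)
  also have "of_bool (s = t) / 2 - Z_op $ s $ t
      = of_bool (s = t \<and> s \<noteq> (\<lambda>_. 0) \<and> s \<noteq> (\<lambda>_. 1)) / 2"
    by (auto simp: Z_op_nth)
  finally show ?thesis .
qed

lemma W2_mult_nth:
  "(W2 q \<phi> *v \<psi>) $ s
    = of_bool (s \<noteq> (\<lambda>_. 0) \<and> s \<noteq> (\<lambda>_. 1)) * \<psi> $ s / 2 - phase \<phi> (s q) * \<psi> $ flip s / 4"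
proof -
  have "W2 q \<phi> $ s $ t * \<psi> $ t
      = (if t = s then of_bool (s \<noteq> (\<lambda>_. 0) \<and> s \<noteq> (\<lambda>_. 1)) * \<psi> $ s / 2 else 0)
        - (if t = flip s then phase \<phi> (s q) * \<psi> $ flip s / 4 else 0)" for t
    by (simp add: W2_nth algebra_simps)
  then show ?thesis
    by (simp add: matrix_vector_mult_def sum_subtractf)
qed

text \<open>Conjugating a phase has the same effect as flipping the bit at \<open>q\<close>, and
  complementation is symmetric in \<open>s\<close> and \<open>t\<close>.\<close>

lemma hermitian_W2: "hermitian (W2 q \<phi>)"
proof -
  have "cnj (W2 q \<phi> $ t $ s) = W2 q \<phi> $ s $ t" for s t
  proof -
    have "s = flip t \<longleftrightarrow> t = flip s"
      by auto
    moreover have "cnj (phase \<phi> (flip s q)) = phase \<phi> (s q)"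
      by (simp add: flip_def phase_def cis_cnj)
    ultimately show ?thesis
      by (auto simp: W2_nth)
  qed
  then show ?thesis
    by (simp add: hermitian_def conj_transpose_def vec_eq_iff)
qed

lemma braket_self: "braket u u = of_real ((norm u)\<^sup>2)"
  unfolding braket_def norm_vec_def L2_set_def
  by (simp add: sum_nonneg complex_norm_square mult.commute del: of_real_power)

text \<open>The order on complex numbers demands a vanishing imaginary part, so the later estimate
  of the real part has to be complemented by this.\<close>

lemma hermitian_braket_real:
  assumes "hermitian A"
  shows "Im (braket v (A *v v)) = 0"
proof -
  have A: "cnj (A $ i $ j) = A $ j $ i" for i j
    using assms by (simp add: hermitian_def conj_transpose_def vec_eq_iff)
  have "cnj (braket v (A *v v)) = (\<Sum>i\<in>UNIV. \<Sum>j\<in>UNIV. v $ i * (A $ j $ i * cnj (v $ j)))"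
    by (simp add: braket_def matrix_vector_mult_def sum_distrib_left A)
  also have "\<dots> = (\<Sum>j\<in>UNIV. \<Sum>i\<in>UNIV. v $ i * (A $ j $ i * cnj (v $ j)))"
    by (rule sum.swap)
  also have "\<dots> = braket v (A *v v)"
    by (simp add: braket_def matrix_vector_mult_def sum_distrib_left mult_ac)
  finally show ?thesis
    by (simp add: complex_eq_iff)
qed

lemma trace_mult_ketbra: "trace (A ** ketbra u v) = braket v (A *v u)"
  by (simp add: trace_def matrix_matrix_mult_def ketbra_def braket_def matrix_vector_mult_def
      sum_distrib_left mult_ac)

text \<open>Both products consist of the same four values of \<open>\<alpha>\<close> and
  \<open>\<beta>\<close> at constant strings on \<open>A\<close> and \<open>- A\<close>, paired
  differently. Since both sides of the bipartition are nonempty, \<open>u\<close> is not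
  constant.\<close>

lemma biproduct_norms:
  assumes "biproduct \<psi>"
  obtains u where "u \<noteq> (\<lambda>_. 0)" "u \<noteq> (\<lambda>_. 1)"
    "norm (\<psi> $ (\<lambda>_. 0)) * norm (\<psi> $ (\<lambda>_. 1)) = norm (\<psi> $ u) * norm (\<psi> $ flip u)"
proof -
  obtain A \<alpha> \<beta> where A: "A \<noteq> {}" "- A \<noteq> {}" and \<psi>: "\<psi> = tensor_bipart A \<alpha> \<beta>"
    using assms by (auto simp: biproduct_def)
  define u :: "'a \<Rightarrow> 2" where "u = (\<lambda>k. if k \<in> A then 0 else 1)"
  have "restrict u A = restrict (\<lambda>_. 0) A" "restrict u (- A) = restrict (\<lambda>_. 1) (- A)"
    "restrict (flip u) A = restrict (\<lambda>_. 1) A" "restrict (flip u) (- A) = restrict (\<lambda>_. 0) (- A)"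
    by (auto simp: u_def flip_def fun_eq_iff restrict_def)
  then have "norm (\<psi> $ (\<lambda>_. 0)) * norm (\<psi> $ (\<lambda>_. 1)) = norm (\<psi> $ u) * norm (\<psi> $ flip u)"
    by (simp add: \<psi> tensor_bipart_def norm_mult mult_ac)
  moreover have "u \<noteq> (\<lambda>_. 0)" "u \<noteq> (\<lambda>_. 1)"
    using A by (auto simp: u_def fun_eq_iff)
  ultimately show thesis
    using that by blast
qed

lemma W2_expectation_nonneg:
  assumes "biproduct \<psi>"
  shows "0 \<le> braket \<psi> (W2 q \<phi> *v \<psi>)"
proof -
  define r where "r s = norm (\<psi> $ s)" for s
  define C :: "('a \<Rightarrow> 2) set" where "C = - {\<lambda>_. 0, \<lambda>_. 1}"
  obtain u where u: "u \<in> C" and r_u: "r (\<lambda>_. 0) * r (\<lambda>_. 1) = r u * r (flip u)"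
    using biproduct_norms[OF assms] unfolding r_def C_def by (metis ComplI empty_iff insert_iff)
  have flip_C: "flip s \<in> C \<longleftrightarrow> s \<in> C" for s
    by (auto simp: C_def)
  have term_ge: "of_bool (s \<in> C) * (r s)\<^sup>2 / 2 - r s * r (flip s) / 4
      \<le> Re (cnj (\<psi> $ s) * (W2 q \<phi> *v \<psi>) $ s)" for s
  proof -
    have "Re (cnj (\<psi> $ s) * (phase \<phi> (s q) * \<psi> $ flip s)) \<le> r s * r (flip s)"
      by (rule order.trans[OF complex_Re_le_cmod]) (simp add: norm_mult r_def)
    moreover have "Re (cnj (\<psi> $ s) * \<psi> $ s) = (r s)\<^sup>2"
      by (simp add: r_def cmod_power2) (simp add: power2_eq_square)
    moreover have "cnj (\<psi> $ s) * (W2 q \<phi> *v \<psi>) $ s = of_real (of_bool (s \<in> C) / 2) * (cnj (\<psi> $ s) * \<psi> $ s)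
        - of_real (1 / 4) * (cnj (\<psi> $ s) * (phase \<phi> (s q) * \<psi> $ flip s))"
      by (simp add: W2_mult_nth C_def algebra_simps)
    ultimately show ?thesis
      by (simp only: minus_complex.sel Re_complex_of_real Im_complex_of_real times_complex.sel) simp
  qed
  have "(\<Sum>s\<in>C. r s * r (flip s)) \<le> (\<Sum>s\<in>C. ((r s)\<^sup>2 + (r (flip s))\<^sup>2) / 2)"
  proof (rule sum_mono)
    fix s
    show "r s * r (flip s) \<le> ((r s)\<^sup>2 + (r (flip s))\<^sup>2) / 2"
      using sum_squares_bound[of "r s" "r (flip s)"] by simp
  qed
  \<comment> \<open>Complementation permutes \<open>C\<close>, so both squares have the same
    sum.\<close>
  also have "\<dots> = (\<Sum>s\<in>C. (r s)\<^sup>2)"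
  proof -
    have "(\<Sum>s\<in>C. (r (flip s))\<^sup>2) = (\<Sum>s\<in>C. (r s)\<^sup>2)"
      by (rule sum.reindex_bij_witness[of _ flip flip]) (auto simp: flip_C)
    then show ?thesis
      by (simp add: sum.distrib flip: sum_divide_distrib)
  qed
  finally have amgm: "(\<Sum>s\<in>C. r s * r (flip s)) \<le> (\<Sum>s\<in>C. (r s)\<^sup>2)" .
  \<comment> \<open>Distinctness makes the two squares separate terms of the sum over
    \<open>C\<close>.\<close>
  have "u \<noteq> flip u"
    by (auto simp: flip_eq_iff)
  then have "(r u)\<^sup>2 + (r (flip u))\<^sup>2 = (\<Sum>s\<in>{u, flip u}. (r s)\<^sup>2)"
    by simp
  also have "\<dots> \<le> (\<Sum>s\<in>C. (r s)\<^sup>2)"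
    using u flip_C by (intro sum_mono2) auto
  finally have pair: "2 * (r u * r (flip u)) \<le> (\<Sum>s\<in>C. (r s)\<^sup>2)"
    using sum_squares_bound[of "r u" "r (flip u)"] by simp
  have UNIV_eq: "UNIV = insert (\<lambda>_. 0) (insert (\<lambda>_. 1) C)"
    by (auto simp: C_def)
  have not_C: "(\<lambda>_. 0) \<notin> C" "(\<lambda>_. 1) \<notin> C"
    by (auto simp: C_def)
  \<comment> \<open>The last coefficient is 1/2 because each of the two constant strings contributes
    1/4. \<open>amgm\<close> leaves a quarter of the sum of squares, which \<open>pair\<close>
    compares with that term.\<close>
  have "0 \<le> (\<Sum>s\<in>C. (r s)\<^sup>2) / 2 - (\<Sum>s\<in>C. r s * r (flip s)) / 4 - r (\<lambda>_. 0) * r (\<lambda>_. 1) / 2"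
    using amgm pair r_u by linarith
  also have "\<dots> = (\<Sum>s\<in>C. (r s)\<^sup>2 / 2 - r s * r (flip s) / 4) - r (\<lambda>_. 0) * r (\<lambda>_. 1) / 2"
    by (simp add: sum_subtractf sum_divide_distrib)
  also have "\<dots> = (\<Sum>s\<in>UNIV. of_bool (s \<in> C) * (r s)\<^sup>2 / 2 - r s * r (flip s) / 4)"
    by (subst UNIV_eq) (simp add: not_C)
  also have "\<dots> \<le> Re (braket \<psi> (W2 q \<phi> *v \<psi>))"
    unfolding braket_def Re_sum by (intro sum_mono term_ge)
  finally show ?thesis
    by (simp add: less_eq_complex_def hermitian_braket_real hermitian_W2)
qed

text \<open>The trace is real-linear in \<open>\<sigma>\<close> and the nonnegative numbers are
  convex, so the bound passes from the pure biproduct states to their convex hull.\<close>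

lemma trace_W2_sep_nonneg:
  assumes "\<sigma> \<in> sep_states"
  shows "0 \<le> trace (W2 q \<phi> ** \<sigma>)"
proof -
  define f where "f \<sigma> = trace (W2 q \<phi> ** \<sigma>)" for \<sigma>
  have "linear f"
  proof (rule linearI)
    show "f (x + y) = f x + f y" for x y
      by (simp add: f_def matrix_add_ldistrib trace_add)
    show "f (c *\<^sub>R x) = c *\<^sub>R f x" for c x
      by (simp add: f_def trace_def matrix_matrix_mult_def scaleR_sum_right)
  qed
  moreover have "convex {z :: complex. 0 \<le> z}"
    by (auto simp: convex_def less_eq_complex_def)
  ultimately have "convex (f -` {z. 0 \<le> z})"
    by (rule convex_linear_vimage)
  moreover have "{ketbra \<psi> \<psi> | \<psi>. norm \<psi> = 1 \<and> biproduct \<psi>} \<subseteq> f -` {z. 0 \<le> z}"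
    by (auto simp: f_def trace_mult_ketbra W2_expectation_nonneg)
  ultimately have "sep_states \<subseteq> f -` {z. 0 \<le> z}"
    unfolding sep_states_def by (rule hull_minimal[rotated])
  then show ?thesis
    using assms by (auto simp: f_def)
qed

lemma ghz_nth:
  "ghz \<phi> $ s = (of_bool (s = (\<lambda>_. 0)) + cis \<phi> * of_bool (s = (\<lambda>_. 1))) / complex_of_real (sqrt 2)"
  by (simp add: ghz_def tensor_vec_ket_nth cis_conv_exp scaleR_conv_of_real[where 'a = complex])

text \<open>On the constant strings the diagonal part vanishes, and the phases
  \<open>cis (- \<phi>)\<close> and \<open>cis \<phi>\<close> turn the amplitude of the
  complementary string into that of the string itself.\<close>

lemma W2_mult_ghz: "W2 q \<phi> *v ghz \<phi> = (- (1 / 4)) *\<^sub>R ghz \<phi>"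
proof -
  have "(W2 q \<phi> *v ghz \<phi>) $ s = (- (1 / 4)) *\<^sub>R ghz \<phi> $ s" for s
    by (auto simp: W2_mult_nth ghz_nth phase_def cis_mult scaleR_conv_of_real)
  then show ?thesis
    by (simp add: vec_eq_iff)
qed

lemma W2_expectation_ghz:
  fixes q :: "'n::finite"
  shows "braket (ghz \<phi>) (W2 q \<phi> *v ghz \<phi>) < 0"
proof -
  define g :: "'n qvec" where "g = ghz \<phi>"
  \<comment> \<open>The expectation value is \<open>- (norm g)\<^sup>2 / 4\<close>, so one nonzero
    coordinate gives strict negativity.\<close>
  have "g $ (\<lambda>_. 0) \<noteq> 0"
    by (simp add: g_def ghz_nth)
  then have "g \<noteq> 0"
    by auto
  have "braket g (W2 q \<phi> *v g) = (- (1 / 4)) *\<^sub>R braket g g"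
    by (simp add: g_def W2_mult_ghz braket_def sum_negf flip: scaleR_sum_right)
  also have "\<dots> = of_real (- (norm g)\<^sup>2 / 4)"
    by (simp add: braket_self scaleR_conv_of_real)
  also have "\<dots> < 0"
    using \<open>g \<noteq> 0\<close> by (simp add: less_complex_def)
  finally show ?thesis
    by (simp add: g_def)
qed

theorem theorem3:
  fixes q :: "'n::finite" and \<phi> :: real
  assumes "CARD('n) \<ge> 2"
  shows "entanglement_witness (W2 q \<phi>) (ketbra (ghz \<phi>) (ghz \<phi>)) \<and>
    (\<forall>\<sigma>\<in>sep_states. 0 \<le> trace (W2 q \<phi> ** \<sigma>)) \<and>
    braket (ghz \<phi>) (W2 q \<phi> *v ghz \<phi>) < 0"
  by (simp add: entanglement_witness_def hermitian_W2 trace_W2_sep_nonneg trace_mult_ketbra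
      W2_expectation_ghz)

end
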